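(* Let $\phi:\mathbb{R}\to\mathbb{R}$ be a margin-based loss function, let $h\in\mathbb{R}^d$, and let $t\ge 1$, $n\ge 1$. Let $(x_1,y_1),\dots,(x_n,y_n)$ be drawn i.i.d. from a distribution $\mathcal{D}$ on a subset of $\mathbb{R}^d\times\{-1,+1\}$, and let $(Q_i^\tau)$, $(p_i^\tau)$, $1\le i\le n$, $1\le\tau\le t$, be the query indicators and query probabilities of the sequential sampling scheme described in the context. Define $$\hat L_t(h)=\frac{1}{nt}\sum_{i=1}^n\sum_{\tau=1}^t\frac{Q_i^\tau}{p_i^\tau}\,\phi(y_i\langle h,x_i\rangle),$$ where $p_i^\tau>0$ for all $i$ and all $\tau=1,\dots,t$. Then $$\mathbb{E}\big[\hat L_t(h)\big]=L(h),$$ where the expectation is over all the random variables $Q_1^1,\dots,Q_n^t$ and the sample $(x_1,y_1),\dots,(x_n,y_n)$.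
   Context: $L(h)=\mathbb{E}_{(x,y)\sim\mathcal{D}}[\phi(y\langle h,x\rangle)]$ is the risk of the linear hypothesis $h$ (assumed well defined and finite). Sampling scheme: in each round $\tau=1,2,\dots$ a probability distribution $(p_1^\tau,\dots,p_n^\tau)$ on the pool $\{x_1,\dots,x_n\}$ is chosen as a function of the data $(x_i,y_i)_{i\le n}$ and of the query indicators of the rounds $1,\dots,\tau-1$. Then exactly one point of the pool is drawn from this distribution. $Q_i^\tau\in\{0,1\}$ equals $1$ if $x_i$ is the point drawn in round $\tau$ and $0$ otherwise, so that, conditionally on the data and on the indicators of rounds $1,\dots,\tau-1$, $\mathbb{P}[Q_i^\tau=1]=p_i^\tau$. Points may be drawn again in later rounds. *)

theory Defs
  imports "HOL-Probability.Probability"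
begin

definition risk :: "((real ^ 'd) \<times> real) measure \<Rightarrow> (real \<Rightarrow> real) \<Rightarrow> real ^ 'd \<Rightarrow> real" where
  "risk D \<phi> h = (LINT z|D. \<phi> (snd z * (h \<bullet> fst z)))"

text \<open>
  \<open>J \<tau> \<omega>\<close> is the index of the pool point drawn in round \<open>\<tau>\<close>, so \<open>query J i \<tau>\<close> is the
  indicator \<open>Q\<^sub>i\<^sup>\<tau>\<close>.  Points are identified by their index: two sample points that happen to
  have the same value are still distinct members of the pool.
\<close>
definition query :: "(nat \<Rightarrow> 'w \<Rightarrow> nat) \<Rightarrow> nat \<Rightarrow> nat \<Rightarrow> 'w \<Rightarrow> real" where
  "query J i \<tau> \<omega> = (if J \<tau> \<omega> = i then 1 else 0)"

type_synonym 'z history = "(nat \<Rightarrow> 'z) \<times> (nat \<times> nat \<Rightarrow> real)"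

text \<open>
  What is known before round \<open>\<tau>\<close>: the labelled sample and all query indicators
  of the rounds \<open>1, \<dots>, \<tau> - 1\<close>.
\<close>
definition history ::
  "nat \<Rightarrow> (nat \<Rightarrow> 'w \<Rightarrow> 'z) \<Rightarrow> (nat \<Rightarrow> 'w \<Rightarrow> nat) \<Rightarrow> nat \<Rightarrow> 'w \<Rightarrow> 'z history" where
  "history n Z J \<tau> \<omega> =
     (restrict (\<lambda>i. Z i \<omega>) {1..n},
      restrict (\<lambda>(i, s). query J i s \<omega>) ({1..n} \<times> {1..<\<tau>}))"

definition history_space :: "nat \<Rightarrow> 'z measure \<Rightarrow> nat \<Rightarrow> 'z history measure" where
  "history_space n D \<tau> =
     (\<Pi>\<^sub>M i\<in>{1..n}. D) \<Otimes>\<^sub>M (\<Pi>\<^sub>M k\<in>{1..n} \<times> {1..<\<tau>}. (borel :: real measure))"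

definition history_algebra ::
  "'w measure \<Rightarrow> 'z measure \<Rightarrow> nat \<Rightarrow> (nat \<Rightarrow> 'w \<Rightarrow> 'z) \<Rightarrow> (nat \<Rightarrow> 'w \<Rightarrow> nat) \<Rightarrow> nat \<Rightarrow> 'w measure"
  where
  "history_algebra M D n Z J \<tau> =
     vimage_algebra (space M) (history n Z J \<tau>) (history_space n D \<tau>)"

text \<open>
  The strategy \<open>\<pi>\<close> maps the history before round \<open>\<tau>\<close> to the vector of query probabilities
  of that round; \<open>query_prob n Z J \<pi> i \<tau>\<close> is the resulting random variable \<open>p\<^sub>i\<^sup>\<tau>\<close>.
\<close>
definition query_prob ::
  "nat \<Rightarrow> (nat \<Rightarrow> 'w \<Rightarrow> 'z) \<Rightarrow> (nat \<Rightarrow> 'w \<Rightarrow> nat) \<Rightarrow> (nat \<Rightarrow> 'z history \<Rightarrow> nat \<Rightarrow> real)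
     \<Rightarrow> nat \<Rightarrow> nat \<Rightarrow> 'w \<Rightarrow> real" where
  "query_prob n Z J \<pi> i \<tau> \<omega> = \<pi> \<tau> (history n Z J \<tau> \<omega>) i"

definition sampling_strategy ::
  "'z measure \<Rightarrow> nat \<Rightarrow> nat \<Rightarrow> (nat \<Rightarrow> 'z history \<Rightarrow> nat \<Rightarrow> real) \<Rightarrow> bool" where
  "sampling_strategy D n t \<pi> \<longleftrightarrow>
     (\<forall>\<tau>\<in>{1..t}.
        (\<forall>i\<in>{1..n}. (\<lambda>\<eta>. \<pi> \<tau> \<eta> i) \<in> borel_measurable (history_space n D \<tau>)) \<and>
        (\<forall>\<eta>\<in>space (history_space n D \<tau>).
           (\<forall>i\<in>{1..n}. 0 \<le> \<pi> \<tau> \<eta> i) \<and> (\<Sum>i=1..n. \<pi> \<tau> \<eta> i) = 1))"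

definition sequential_sampling ::
  "'w measure \<Rightarrow> 'z measure \<Rightarrow> nat \<Rightarrow> nat \<Rightarrow> (nat \<Rightarrow> 'w \<Rightarrow> 'z) \<Rightarrow> (nat \<Rightarrow> 'w \<Rightarrow> nat)
     \<Rightarrow> (nat \<Rightarrow> 'z history \<Rightarrow> nat \<Rightarrow> real) \<Rightarrow> bool" where
  "sequential_sampling M D n t Z J \<pi> \<longleftrightarrow>
     sampling_strategy D n t \<pi> \<and>
     (\<forall>\<tau>\<in>{1..t}.
        J \<tau> \<in> measurable M (count_space {1..n}) \<and>
        (\<forall>i\<in>{1..n}. AE \<omega> in M.
           real_cond_exp M (history_algebra M D n Z J \<tau>)
             (indicator {\<omega>' \<in> space M. query J i \<tau> \<omega>' = 1}) \<omega>
           = query_prob n Z J \<pi> i \<tau> \<omega>))"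

definition weighted_risk ::
  "nat \<Rightarrow> nat \<Rightarrow> (nat \<Rightarrow> 'w \<Rightarrow> (real ^ 'd) \<times> real) \<Rightarrow> (nat \<Rightarrow> 'w \<Rightarrow> nat)
     \<Rightarrow> (nat \<Rightarrow> ((real ^ 'd) \<times> real) history \<Rightarrow> nat \<Rightarrow> real)
     \<Rightarrow> (real \<Rightarrow> real) \<Rightarrow> real ^ 'd \<Rightarrow> 'w \<Rightarrow> real" where
  "weighted_risk n t Z J \<pi> \<phi> h \<omega> =
     1 / (real n * real t) *
       (\<Sum>i=1..n. \<Sum>\<tau>=1..t.
          query J i \<tau> \<omega> / query_prob n Z J \<pi> i \<tau> \<omega>
            * \<phi> (snd (Z i \<omega>) * (h \<bullet> fst (Z i \<omega>))))"

end

theory Submission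
  imports Defs
begin

text \<open>
  For fixed \<open>i\<close> and \<open>\<tau>\<close>, both the loss at \<open>x\<^sub>i\<close> and \<open>p\<^sub>i\<^sup>\<tau>\<close> are determined by the history before
  round \<open>\<tau>\<close>, so conditioning on this history replaces \<open>Q\<^sub>i\<^sup>\<tau>\<close> by \<open>p\<^sub>i\<^sup>\<tau>\<close>, which cancels the weight.
  As \<open>1 / p\<^sub>i\<^sup>\<tau>\<close> may be unbounded, integrability of the weighted loss is not automatic; it follows
  from the same computation for nonnegative integrals, which needs no integrability.
\<close>

text \<open>\<open>real_cond_exp\<close> is a difference of two \<open>enn2real\<close> values, for
  the positive and the negative part. The negative part of \<open>g\<close> is 0, and the
  conditional expectation of the positive part has finite integral, hence is finite a.e., so
  \<open>enn2real\<close> loses nothing.\<close>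

lemma (in sigma_finite_subalgebra) nn_cond_exp_eq_real_cond_exp:
  fixes g :: "'a \<Rightarrow> real"
  assumes int: "integrable M g" and nonneg: "\<And>x. 0 \<le> g x"
  shows "AE x in M. nn_cond_exp M F (\<lambda>x. ennreal (g x)) x = ennreal (real_cond_exp M F g x)"
proof -
  have [measurable]: "g \<in> borel_measurable M" using int by simp
  let ?G = "nn_cond_exp M F (\<lambda>x. ennreal (g x))"
  have "(\<integral>\<^sup>+x. 1 * ?G x \<partial>M) = (\<integral>\<^sup>+x. 1 * ennreal (g x) \<partial>M)"
    by (rule nn_cond_exp_intg) auto
  also have "\<dots> < \<infinity>"
    using integrableD(2)[OF int] nonneg by (simp add: less_top)
  finally have "(\<integral>\<^sup>+x. ?G x \<partial>M) \<noteq> \<infinity>" by simp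
  then have "AE x in M. ?G x \<noteq> \<infinity>"
    by (intro nn_integral_PInf_AE) auto
  moreover have "AE x in M. nn_cond_exp M F (\<lambda>x. ennreal (- g x)) x = 0"
    using nn_cond_exp_F_meas[of "\<lambda>_. 0"] nonneg by (auto simp: ennreal_neg)
  ultimately show ?thesis
    by eventually_elim (simp add: real_cond_exp_def less_top)
qed

text \<open>\<open>real_cond_exp_intg\<close> presupposes integrability of the product. Here it is
  obtained by pulling \<bar>f\<bar> out of the nonnegative conditional expectation, where both sides
  may be infinite.\<close>

lemma (in sigma_finite_subalgebra) integrable_mult_of_real_cond_exp:
  fixes f g :: "'a \<Rightarrow> real"
  assumes int: "integrable M g" and nonneg: "\<And>x. 0 \<le> g x"
    and [measurable]: "f \<in> borel_measurable F"
    and int_cond: "integrable M (\<lambda>x. f x * real_cond_exp M F g x)"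
  shows "integrable M (\<lambda>x. f x * g x)"
proof (rule integrableI_bounded)
  have [measurable]: "g \<in> borel_measurable M" using int by simp
  have [measurable]: "f \<in> borel_measurable M"
    by (rule measurable_from_subalg[OF subalg]) measurable
  show "(\<lambda>x. f x * g x) \<in> borel_measurable M" by measurable
  have "(\<integral>\<^sup>+x. norm (f x * g x) \<partial>M) = (\<integral>\<^sup>+x. ennreal \<bar>f x\<bar> * ennreal (g x) \<partial>M)"
    using nonneg by (simp add: abs_mult ennreal_mult)
  also have "\<dots> = (\<integral>\<^sup>+x. ennreal \<bar>f x\<bar> * nn_cond_exp M F (\<lambda>x. ennreal (g x)) x \<partial>M)"
    by (rule nn_cond_exp_intg[symmetric]) auto
  \<comment> \<open>Settling for \<le> avoids a separate proof that
    \<open>real_cond_exp M F g\<close> is nonnegative: a real number is at most its absolute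
    value.\<close>
  also have "\<dots> \<le> (\<integral>\<^sup>+x. norm (f x * real_cond_exp M F g x) \<partial>M)"
  proof (rule nn_integral_mono_AE)
    show "AE x in M. ennreal \<bar>f x\<bar> * nn_cond_exp M F (\<lambda>x. ennreal (g x)) x
        \<le> ennreal (norm (f x * real_cond_exp M F g x))"
      using nn_cond_exp_eq_real_cond_exp[OF int nonneg]
      by eventually_elim (auto simp: abs_mult ennreal_mult intro!: mult_left_mono ennreal_leI)
  qed
  also have "\<dots> < \<infinity>"
    using int_cond by (simp add: integrable_iff_bounded)
  finally show "(\<integral>\<^sup>+x. norm (f x * g x) \<partial>M) < \<infinity>" .
qed

text \<open>The Horvitz-Thompson identity in conditional form: \<open>u / p\<close> is known given
  \<open>F\<close>, so it leaves the conditional expectation, and the remaining E[g | F] = p cancels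
  the denominator.\<close>

lemma (in sigma_finite_subalgebra) inverse_probability_weighting:
  fixes g p u :: "'a \<Rightarrow> real"
  assumes int_g: "integrable M g" and nonneg: "\<And>x. 0 \<le> g x"
    and p [measurable]: "p \<in> borel_measurable F" and p_pos: "AE x in M. 0 < p x"
    and cond: "AE x in M. real_cond_exp M F g x = p x"
    and u [measurable]: "u \<in> borel_measurable F" and int_u: "integrable M u"
  shows "integrable M (\<lambda>x. g x / p x * u x)"
    and "(\<integral>x. g x / p x * u x \<partial>M) = (\<integral>x. u x \<partial>M)"
proof -
  let ?f = "\<lambda>x. u x / p x"
  have [measurable]: "g \<in> borel_measurable M" using int_g by simp
  have f [measurable]: "?f \<in> borel_measurable F" by measurable
  have [measurable]: "p \<in> borel_measurable M" "u \<in> borel_measurable M"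
    by (rule measurable_from_subalg[OF subalg], measurable)+
  \<comment> \<open>Positivity of \<open>p\<close> enters here: where \<open>p x = 0\<close>,
    division by zero would make the left side 0 instead of \<open>u x\<close>.\<close>
  have cancel: "AE x in M. ?f x * real_cond_exp M F g x = u x"
    using p_pos cond by eventually_elim simp
  have "integrable M (\<lambda>x. ?f x * real_cond_exp M F g x)"
    using int_u by (subst integrable_cong_AE[OF _ _ cancel]) simp_all
  then have int: "integrable M (\<lambda>x. ?f x * g x)"
    by (rule integrable_mult_of_real_cond_exp[OF int_g nonneg f])
  then show "integrable M (\<lambda>x. g x / p x * u x)"
    by (simp add: mult.commute)
  have "(\<integral>x. g x / p x * u x \<partial>M) = (\<integral>x. ?f x * g x \<partial>M)"
    by (simp add: mult.commute)
  also have "\<dots> = (\<integral>x. ?f x * real_cond_exp M F g x \<partial>M)"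
    using int by (intro real_cond_exp_intg(2)[symmetric]) auto
  also have "\<dots> = (\<integral>x. u x \<partial>M)"
    by (rule integral_cong_AE[OF _ _ cancel]) measurable
  finally show "(\<integral>x. g x / p x * u x \<partial>M) = (\<integral>x. u x \<partial>M)" .
qed

lemma measurable_query:
  assumes "J \<tau> \<in> measurable M (count_space A)"
  shows "query J i \<tau> \<in> borel_measurable M"
proof -
  note assms[measurable]
  show ?thesis unfolding query_def[abs_def] by measurable
qed

lemma measurable_history:
  assumes Z: "\<And>i. i \<in> {1..n} \<Longrightarrow> Z i \<in> measurable M D"
    and J: "\<And>s. s \<in> {1..<\<tau>} \<Longrightarrow> J s \<in> measurable M (count_space {1..n})"
  shows "history n Z J \<tau> \<in> measurable M (history_space n D \<tau>)"
proof -
  have "(\<lambda>\<omega>. \<lambda>i\<in>{1..n}. Z i \<omega>) \<in> measurable M (\<Pi>\<^sub>M i\<in>{1..n}. D)"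
    using Z by (rule measurable_restrict)
  moreover have "(\<lambda>\<omega>. \<lambda>k\<in>{1..n} \<times> {1..<\<tau>}. query J (fst k) (snd k) \<omega>)
      \<in> measurable M (\<Pi>\<^sub>M k\<in>{1..n} \<times> {1..<\<tau>}. borel)"
    using measurable_query[OF J] by (intro measurable_restrict) auto
  ultimately show ?thesis
    unfolding history_def[abs_def] history_space_def case_prod_beta by (rule measurable_Pair)
qed

lemma subalgebra_history_algebra:
  assumes "history n Z J \<tau> \<in> measurable M (history_space n D \<tau>)"
  shows "subalgebra M (history_algebra M D n Z J \<tau>)"
  unfolding subalgebra_def history_algebra_def
  using sets_image_in_sets[OF refl assms] by simp

lemma measurable_history_algebra:
  assumes H: "history n Z J \<tau> \<in> measurable M (history_space n D \<tau>)"
  shows "history n Z J \<tau> \<in> measurable (history_algebra M D n Z J \<tau>) (history_space n D \<tau>)"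
  unfolding history_algebra_def
  using measurable_space[OF H] by (intro measurable_vimage_algebra1) auto

text \<open>Every history contains the whole labelled sample, so \<open>Z i\<close> is a coordinate
  of it. This is what makes the loss at a pool point known before the draw.\<close>

lemma measurable_sample_history_algebra:
  assumes H: "history n Z J \<tau> \<in> measurable M (history_space n D \<tau>)" and i: "i \<in> {1..n}"
  shows "Z i \<in> measurable (history_algebra M D n Z J \<tau>) D"
proof -
  have "(\<lambda>\<eta>. fst \<eta> i) \<in> measurable (history_space n D \<tau>) D"
    unfolding history_space_def using i by measurable
  from measurable_compose[OF measurable_history_algebra[OF H] this]
  show ?thesis using i by (simp add: history_def)
qed

lemma integrable_query:
  assumes "prob_space M" and J: "J \<tau> \<in> measurable M (count_space A)"
  shows "integrable M (query J i \<tau>)"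
proof -
  interpret prob_space M by fact
  show ?thesis
    by (rule integrable_const_bound[where B = 1])
      (simp_all add: query_def measurable_query[where J = J and \<tau> = \<tau>, OF J])
qed

text \<open>Passes from the conditional probability in \<open>sequential_sampling\<close> to the
  conditional expectation of \<open>query\<close>. The indicator is cut down to
  \<open>space M\<close>, so the two functions agree there, which suffices almost
  everywhere.\<close>

lemma real_cond_exp_query:
  assumes "sequential_sampling M D n t Z J \<pi>" and "\<tau> \<in> {1..t}" and "i \<in> {1..n}"
    and sub: "sigma_finite_subalgebra M (history_algebra M D n Z J \<tau>)"
  shows "AE \<omega> in M. real_cond_exp M (history_algebra M D n Z J \<tau>) (query J i \<tau>) \<omega>
           = query_prob n Z J \<pi> i \<tau> \<omega>"
proof -
  interpret sigma_finite_subalgebra M "history_algebra M D n Z J \<tau>" by fact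
  let ?A = "{\<omega>' \<in> space M. query J i \<tau> \<omega>' = 1}"
  have J: "J \<tau> \<in> measurable M (count_space {1..n})"
    and cond: "AE \<omega> in M. real_cond_exp M (history_algebra M D n Z J \<tau>) (indicator ?A) \<omega>
      = query_prob n Z J \<pi> i \<tau> \<omega>"
    using assms unfolding sequential_sampling_def by auto
  note [measurable] = measurable_query[where J = J and \<tau> = \<tau>, OF J]
  have "AE \<omega> in M. query J i \<tau> \<omega> = indicator ?A \<omega>"
    by (auto simp: indicator_def query_def)
  then have "AE \<omega> in M. real_cond_exp M (history_algebra M D n Z J \<tau>) (query J i \<tau>) \<omega>
      = real_cond_exp M (history_algebra M D n Z J \<tau>) (indicator ?A) \<omega>"
    by (rule real_cond_exp_cong) measurable
  with cond show ?thesis by eventually_elim simp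
qed

text \<open>One summand of the estimator: inverse weighting given the history before round \<tau>
  removes the query, and the law of \<open>Z i\<close> turns the remaining integral over
  \<open>M\<close> into one over \<open>D\<close>.\<close>

lemma expectation_weighted_sample:
  fixes u :: "'z \<Rightarrow> real"
  assumes "prob_space M"
    and Z: "\<And>j. j \<in> {1..n} \<Longrightarrow> Z j \<in> measurable M D"
    and distr: "distr M D (Z i) = D"
    and seq: "sequential_sampling M D n t Z J \<pi>"
    and i: "i \<in> {1..n}" and \<tau>: "\<tau> \<in> {1..t}"
    and pos: "AE \<omega> in M. query_prob n Z J \<pi> i \<tau> \<omega> > 0"
    and u: "integrable D u"
  shows "integrable M (\<lambda>\<omega>. query J i \<tau> \<omega> / query_prob n Z J \<pi> i \<tau> \<omega> * u (Z i \<omega>))"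
    and "(\<integral>\<omega>. query J i \<tau> \<omega> / query_prob n Z J \<pi> i \<tau> \<omega> * u (Z i \<omega>) \<partial>M) = (\<integral>z. u z \<partial>D)"
proof -
  let ?F = "history_algebra M D n Z J \<tau>"
  have J: "J s \<in> measurable M (count_space {1..n})" if "s \<in> {1..t}" for s
    using seq that unfolding sequential_sampling_def by auto
  \<comment> \<open>The history stops at round \<tau> - 1, so all draws in it lie in
    \<open>{1..t}\<close>, where \<open>J\<close> is known to be measurable.\<close>
  have H: "history n Z J \<tau> \<in> measurable M (history_space n D \<tau>)"
    using \<tau> by (intro measurable_history Z J) auto
  interpret prob_space M by fact
  \<comment> \<open>Since \<open>M\<close> is finite, being a subalgebra already gives the
    sigma-finiteness that conditional expectations require.\<close>
  interpret finite_measure_subalgebra M ?F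
    by unfold_locales (rule subalgebra_history_algebra[OF H])
  have "(\<lambda>\<eta>. \<pi> \<tau> \<eta> i) \<in> borel_measurable (history_space n D \<tau>)"
    using seq i \<tau> unfolding sequential_sampling_def sampling_strategy_def by auto
  from measurable_compose[OF measurable_history_algebra[OF H] this]
  have p: "query_prob n Z J \<pi> i \<tau> \<in> borel_measurable ?F"
    by (simp add: query_prob_def[abs_def])
  have uZ: "(\<lambda>\<omega>. u (Z i \<omega>)) \<in> borel_measurable ?F"
    using measurable_sample_history_algebra[OF H i] borel_measurable_integrable[OF u]
    by (rule measurable_compose)
  have int: "integrable M (\<lambda>\<omega>. u (Z i \<omega>))"
    using integrable_distr[OF Z[OF i]] u by (simp add: distr)
  have nonneg: "0 \<le> query J i \<tau> \<omega>" for \<omega>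
    by (simp add: query_def)
  note ipw = inverse_probability_weighting[OF
    integrable_query[where J = J and \<tau> = \<tau>, OF prob_space_axioms J[OF \<tau>]] nonneg p pos
    real_cond_exp_query[OF seq \<tau> i sigma_finite_subalgebra_axioms] uZ int]
  show "integrable M (\<lambda>\<omega>. query J i \<tau> \<omega> / query_prob n Z J \<pi> i \<tau> \<omega> * u (Z i \<omega>))"
    by (rule ipw(1))
  have "(\<integral>\<omega>. u (Z i \<omega>) \<partial>M) = (\<integral>z. u z \<partial>distr M D (Z i))"
    using borel_measurable_integrable[OF u] by (rule integral_distr[OF Z[OF i], symmetric])
  with ipw(2) show "(\<integral>\<omega>. query J i \<tau> \<omega> / query_prob n Z J \<pi> i \<tau> \<omega> * u (Z i \<omega>) \<partial>M)
      = (\<integral>z. u z \<partial>D)"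
    by (simp add: distr)
qed

theorem theorem1:
  fixes M :: "'w measure"
    and S :: "((real ^ 'd) \<times> real) set"
    and D :: "((real ^ 'd) \<times> real) measure"
    and \<phi> :: "real \<Rightarrow> real"
    and h :: "real ^ 'd"
    and n t :: nat
    and Z :: "nat \<Rightarrow> 'w \<Rightarrow> (real ^ 'd) \<times> real"
    and J :: "nat \<Rightarrow> 'w \<Rightarrow> nat"
    and \<pi> :: "nat \<Rightarrow> ((real ^ 'd) \<times> real) history \<Rightarrow> nat \<Rightarrow> real"
  assumes "n \<ge> 1" and "t \<ge> 1"
    and "S \<subseteq> UNIV \<times> {-1, 1}"
    and "prob_space D" and "sets D = sets (restrict_space borel S)"
    and "integrable D (\<lambda>z. \<phi> (snd z * (h \<bullet> fst z)))"
    and "prob_space M"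
    and "prob_space.indep_vars M (\<lambda>_. D) Z {1..n}"
    and "\<And>i. i \<in> {1..n} \<Longrightarrow> distr M D (Z i) = D"
    and "sequential_sampling M D n t Z J \<pi>"
    and "\<And>i \<tau>. i \<in> {1..n} \<Longrightarrow> \<tau> \<in> {1..t} \<Longrightarrow> AE \<omega> in M. query_prob n Z J \<pi> i \<tau> \<omega> > 0"
  shows "integrable M (weighted_risk n t Z J \<pi> \<phi> h) \<and>
         prob_space.expectation M (weighted_risk n t Z J \<pi> \<phi> h) = risk D \<phi> h"
proof -
  let ?u = "\<lambda>z. \<phi> (snd z * (h \<bullet> fst z))"
  let ?X = "\<lambda>i \<tau> \<omega>. query J i \<tau> \<omega> / query_prob n Z J \<pi> i \<tau> \<omega> * ?u (Z i \<omega>)"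
  \<comment> \<open>Measurability of each sample point is part of \<open>indep_vars\<close>.\<close>
  have "Z i \<in> measurable M D" if "i \<in> {1..n}" for i
    using assms(8) that by (simp add: prob_space.indep_vars_def2[OF assms(7)])
  note X = expectation_weighted_sample[OF assms(7) this assms(9) assms(10) _ _ assms(11) assms(6)]
  have W: "weighted_risk n t Z J \<pi> \<phi> h
      = (\<lambda>\<omega>. 1 / (real n * real t) * (\<Sum>i=1..n. \<Sum>\<tau>=1..t. ?X i \<tau> \<omega>))"
    by (simp add: weighted_risk_def fun_eq_iff)
  have "integrable M (weighted_risk n t Z J \<pi> \<phi> h)"
    unfolding W by (intro integrable_mult_right Bochner_Integration.integrable_sum X(1)) auto
  moreover have "(\<integral>\<omega>. weighted_risk n t Z J \<pi> \<phi> h \<omega> \<partial>M)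
      = 1 / (real n * real t) * (\<Sum>i=1..n. \<Sum>\<tau>=1..t. \<integral>\<omega>. ?X i \<tau> \<omega> \<partial>M)"
    \<comment> \<open>Exchanging integral and sums needs each summand to be integrable, which is
      \<open>X(1)\<close>. Linearity then handles the rounds one by one, however they depend on each
      other.\<close>
    unfolding W integral_mult_right_zero
    by (simp only: Bochner_Integration.integral_sum Bochner_Integration.integrable_sum X(1) cong: sum.cong)
  moreover have "\<dots> = 1 / (real n * real t) * (\<Sum>i=1..n. \<Sum>\<tau>=1..t. risk D \<phi> h)"
    unfolding risk_def by (intro arg_cong2[where f = "(*)"] refl sum.cong X(2)) auto
  \<comment> \<open>There are \<open>n * t\<close> equal terms; \<open>n \<ge> 1\<close> and
    \<open>t \<ge> 1\<close> keep the factor in front from being 1 / 0 = 0.\<close>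
  moreover have "\<dots> = risk D \<phi> h"
    using assms(1,2) by simp
  ultimately show ?thesis by simp
qed

end
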